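(* Let $p\ge 1$ be an integer and let $f:[0,1]\to\mathbb{R}$ be $(p-1)$-times continuously differentiable with $f^{(p-1)}$ absolutely continuous on $[0,1]$, having Radon--Nikodym derivative $g=(f^{(p-1)})'$. Assume that $g\ne 0$ a.e. in $[0,1]$. Then $R^{p,n}(f)\to 1$ as $n\to\infty$, and $R^{a,n}(f)\to 1$ as $n\to\infty$ for any integer $q\ge p$ and any filter $a\in\mathcal{A}(p,q)$.
   Context: For integers $1\le p\le q$, $\mathcal{A}(p,q)$ is the set of filters $a=(a_0,\dots,a_q)\in\mathbb{R}^{q+1}$ such that $\sum_{\ell=0}^q \ell^i a_\ell=0$ for $i=0,\dots,p-1$ and $\sum_{\ell=0}^q \ell^p a_\ell\ne 0$ (with $0^0=1$). For $f:[0,1]\to\mathbb{R}$, a filter $a\in\mathcal{A}(p,q)$ and $n>q$, put $\Delta^{a,n}_j f=\sum_{\ell=0}^q a_\ell f\big(\frac{j+\ell}{n}\big)$, $j=0,\dots,n-q$, and $$R^{a,n}(f)=\frac{1}{n-q}\sum_{k=0}^{n-q-1}\frac{|\Delta^{a,n}_k f+\Delta^{a,n}_{k+1}f|}{|\Delta^{a,n}_k f|+|\Delta^{a,n}_{k+1}f|},$$ with the convention $\frac00:=1$. $R^{p,n}(f)$ denotes $R^{a,n}(f)$ for the special filter $q=p$, $a_\ell=(-1)^{p-\ell}\binom{p}{\ell}$. *)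

theory Defs
  imports "HOL-Analysis.Analysis"
begin

text \<open>The derivatives are taken within \<open>S\<close>, hence are one-sided at the endpoints of a closed
  interval, and only the values of \<open>f\<close> on \<open>S\<close> matter.\<close>

primrec higher_deriv_on :: "real set \<Rightarrow> nat \<Rightarrow> (real \<Rightarrow> real) \<Rightarrow> real \<Rightarrow> real" where
  "higher_deriv_on S 0 f = f"
| "higher_deriv_on S (Suc k) f =
     (\<lambda>x. vector_derivative (higher_deriv_on S k f) (at x within S))"

definition times_cont_differentiable_on :: "nat \<Rightarrow> (real \<Rightarrow> real) \<Rightarrow> real set \<Rightarrow> bool" where
  "times_cont_differentiable_on k f S \<longleftrightarrow>
     (\<forall>i<k. higher_deriv_on S i f differentiable_on S) \<and> continuous_on S (higher_deriv_on S k f)"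

text \<open>The library's \<^const>\<open>absolutely_continuous\<close> is a relation between measures; this is the
  epsilon-delta notion for functions on \<open>[a, b]\<close>.\<close>

definition abs_continuous_on_interval :: "(real \<Rightarrow> real) \<Rightarrow> real \<Rightarrow> real \<Rightarrow> bool" where
  "abs_continuous_on_interval F a b \<longleftrightarrow>
     (\<forall>\<epsilon>>0. \<exists>\<delta>>0. \<forall>(m::nat) (u::nat \<Rightarrow> real) (v::nat \<Rightarrow> real).
        (\<forall>i<m. a \<le> u i \<and> u i \<le> v i \<and> v i \<le> b) \<longrightarrow>
        (\<forall>i<m. \<forall>j<m. i \<noteq> j \<longrightarrow> {u i<..<v i} \<inter> {u j<..<v j} = {}) \<longrightarrow>
        (\<Sum>i<m. v i - u i) < \<delta> \<longrightarrow>
        (\<Sum>i<m. \<bar>F (v i) - F (u i)\<bar>) < \<epsilon>)"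

text \<open>\<open>g\<close> is the density, with respect to Lebesgue measure on \<open>[a, b]\<close>, of the signed measure
  with distribution function \<open>F\<close>. The library's \<^const>\<open>RN_deriv\<close> covers only non-negative
  measures. As usual, \<open>g\<close> is determined only up to null sets.\<close>

definition has_RN_derivative_on :: "(real \<Rightarrow> real) \<Rightarrow> (real \<Rightarrow> real) \<Rightarrow> real \<Rightarrow> real \<Rightarrow> bool" where
  "has_RN_derivative_on F g a b \<longleftrightarrow>
     set_integrable lebesgue {a..b} g \<and>
     (\<forall>x y. a \<le> x \<longrightarrow> x \<le> y \<longrightarrow> y \<le> b \<longrightarrow> F y - F x = (LINT t:{x..y}|lebesgue. g t))"

text \<open>A vector \<open>(a\<^sub>0, \<dots>, a\<^sub>q)\<close> is represented by a function on \<open>nat\<close>; only its values at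
  \<open>0, \<dots>, q\<close> are ever used. Note that \<open>0 ^ 0 = 1\<close> holds in the library.\<close>

definition filters :: "nat \<Rightarrow> nat \<Rightarrow> (nat \<Rightarrow> real) set" where
  "filters p q = {a. (\<forall>i<p. (\<Sum>l=0..q. real l ^ i * a l) = 0) \<and>
                     (\<Sum>l=0..q. real l ^ p * a l) \<noteq> 0}"

definition gen_increment :: "nat \<Rightarrow> (nat \<Rightarrow> real) \<Rightarrow> nat \<Rightarrow> nat \<Rightarrow> (real \<Rightarrow> real) \<Rightarrow> real" where
  "gen_increment q a n j f = (\<Sum>l=0..q. a l * f (real (j + l) / real n))"

definition ratio_conv :: "real \<Rightarrow> real \<Rightarrow> real" where
  "ratio_conv x y = (if x = 0 \<and> y = 0 then 1 else x / y)"

text \<open>Meaningful for \<open>n > q\<close>.\<close>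

definition increment_ratio :: "nat \<Rightarrow> (nat \<Rightarrow> real) \<Rightarrow> nat \<Rightarrow> (real \<Rightarrow> real) \<Rightarrow> real" where
  "increment_ratio q a n f =
     1 / real (n - q) *
     (\<Sum>k<n - q. ratio_conv
        \<bar>gen_increment q a n k f + gen_increment q a n (k + 1) f\<bar>
        (\<bar>gen_increment q a n k f\<bar> + \<bar>gen_increment q a n (k + 1) f\<bar>))"

definition binomial_filter :: "nat \<Rightarrow> nat \<Rightarrow> real" where
  "binomial_filter p l = (- 1) ^ (p - l) * real (p choose l)"

definition binomial_increment_ratio :: "nat \<Rightarrow> nat \<Rightarrow> (real \<Rightarrow> real) \<Rightarrow> real" where
  "binomial_increment_ratio p n f = increment_ratio p (binomial_filter p) n f"

end

theory Submission
  imports Defs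
begin

text \<open>
  A summand of the increment ratio differs from \<open>1\<close> only if consecutive increments have strictly
  opposite signs. Subtracting \<open>v (x - k/n)\<^sup>p / p!\<close> from \<open>f\<close> before Taylor expanding at \<open>k/n\<close> shows,
  for every constant \<open>v\<close>, that \<open>n\<^sup>p \<Delta>\<^sub>k f\<close> is within \<open>C n \<integral> \<bar>g - v\<bar>\<close> of \<open>c v\<close>, where
  \<open>c = (\<Sum> l\<^sup>p a\<^sub>l) / p! \<noteq> 0\<close> and the integral is over the window of length \<open>q/n\<close> at \<open>k/n\<close>. Hence a sign
  change at \<open>k\<close> forces \<open>\<bar>v\<bar> \<le> C' n \<integral> \<bar>g - v\<bar>\<close> over a slightly longer window, for all \<open>v\<close>. Taking
  \<open>v = h(k/n)\<close> with \<open>h\<close> continuous and close to \<open>g\<close> in \<open>L\<^sup>1\<close>, and summing over these \<open>k\<close>, bounds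
  the integral of \<open>\<bar>g\<bar>\<close> over the sign-change windows by an arbitrarily small number; as \<open>g \<noteq> 0\<close>
  almost everywhere, the proportion of sign changes tends to \<open>0\<close>.
\<close>

section \<open>Approximation of integrable functions by continuous ones in
  \<open>L^1\<close>\<close>

lemma dominated_convergence_ae_zero:
  fixes f :: "nat \<Rightarrow> real \<Rightarrow> real"
  assumes f: "\<And>k. f k integrable_on S" and h: "h integrable_on S"
    and le: "\<And>k x. x \<in> S \<Longrightarrow> \<bar>f k x\<bar> \<le> h x"
    and N: "negligible N" and lim: "\<And>x. x \<in> S - N \<Longrightarrow> (\<lambda>k. f k x) \<longlonglongrightarrow> 0"
  shows "(\<lambda>k. integral S (f k)) \<longlonglongrightarrow> 0"
proof -
  \<comment> \<open>\<open>dominated_convergence\<close> asks for convergence at every point of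
    \<open>S\<close>. Overwriting with \<open>0\<close> on \<open>N\<close> supplies it and changes
    no integral.\<close>
  let ?f = "\<lambda>k x. if x \<in> N then 0 else f k x"
  have "(\<lambda>k. integral S (?f k)) \<longlonglongrightarrow> integral S (\<lambda>x. 0::real)"
  proof (rule dominated_convergence(2)[where h = h])
    show "?f k integrable_on S" for k
      by (rule integrable_spike[OF f N]) auto
    show "norm (?f k x) \<le> h x" if "x \<in> S" for k x
      using le[OF that] by (auto intro: order_trans[OF abs_ge_zero])
    show "(\<lambda>k. ?f k x) \<longlonglongrightarrow> 0" if "x \<in> S" for x
      using lim[of x] that by (cases "x \<in> N") auto
  qed (use h in auto)
  moreover have "integral S (?f k) = integral S (f k)" for k
    by (rule integral_spike[OF N]) auto
  ultimately show ?thesis by simp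
qed

text \<open>The triangle inequality runs through \<open>cl M (g x)\<close>. First \<open>M\<close>
  is chosen, by dominated convergence below \<open>|g|\<close>; then, with \<open>M\<close> fixed,
  the index \<open>n\<close> of the clamped continuous sequence, now dominated by
  \<open>2 * M\<close>. Each half costs less than \<open>e / 2\<close>.\<close>

lemma absolutely_integrable_approximate_continuous:
  fixes g :: "real \<Rightarrow> real"
  assumes g: "g absolutely_integrable_on {a..b}" and e: "e > 0"
  obtains h where "continuous_on UNIV h" "integral {a..b} (\<lambda>x. \<bar>g x - h x\<bar>) < e"
proof -
  \<comment> \<open>clamping to \<open>[-M, M]\<close> makes the continuous approximations from \<^const>\<open>measurable_on\<close> dominated\<close>
  define cl where "cl M y = max (- real M) (min (real M) y)" for M y
  have cl_lip: "\<bar>cl M x - cl M y\<bar> \<le> \<bar>x - y\<bar>" and cl_bd: "\<bar>cl M x\<bar> \<le> real M"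
    and cl_near: "\<bar>x - cl M x\<bar> \<le> \<bar>x\<bar>" for M x y
    by (auto simp: cl_def)
  have cl_cont: "continuous_on S (\<lambda>x. cl M (u x))" if "continuous_on S u" for S M and u :: "real \<Rightarrow> real"
    unfolding cl_def by (intro continuous_intros that)
  have cl_int: "(\<lambda>x. cl M (g x)) absolutely_integrable_on {a..b}" for M
    unfolding cl_def
    by (intro absolutely_integrable_max_1 absolutely_integrable_min_1 g) auto
  have "g \<in> borel_measurable (lebesgue_on {a..b})"
    using g absolutely_integrable_measurable[of "{a..b}" g] by auto
  then have "g measurable_on {a..b}"
    by (simp add: measurable_on_iff_borel_measurable)
  then obtain N H where N: "negligible N" and H: "\<And>n. continuous_on UNIV (H n)"
    and lim: "\<And>x. x \<notin> N \<Longrightarrow> (\<lambda>n. H n x) \<longlonglongrightarrow> (if x \<in> {a..b} then g x else 0)"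
    unfolding measurable_on_def by metis
  have absint: "(\<lambda>x. \<bar>u x - w x\<bar>) integrable_on {a..b}"
    if "u absolutely_integrable_on {a..b}" "w absolutely_integrable_on {a..b}" for u w :: "real \<Rightarrow> real"
    using set_integrable_abs[OF set_integral_diff(1)[OF that]] set_lebesgue_integral_eq_integral(1) by blast
  have "(\<lambda>M. integral {a..b} (\<lambda>x. \<bar>g x - cl M (g x)\<bar>)) \<longlonglongrightarrow> 0"
  proof (rule dominated_convergence_ae_zero[where h = "\<lambda>x. \<bar>g x\<bar>" and N = "{}"])
    fix x
    obtain M0 where "\<bar>g x\<bar> \<le> real M0" using real_arch_simple by blast
    then have "\<bar>g x - cl M (g x)\<bar> = 0" if "M \<ge> M0" for M
      using that unfolding cl_def by (auto simp: max_def min_def)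
    then show "(\<lambda>M. \<bar>g x - cl M (g x)\<bar>) \<longlonglongrightarrow> 0"
      by (intro tendsto_eventually eventually_sequentiallyI[of M0]) auto
  qed (use absint[OF g cl_int] absint[OF g, of "\<lambda>x. 0"] cl_near in auto)
  then obtain M where M: "integral {a..b} (\<lambda>x. \<bar>g x - cl M (g x)\<bar>) < e / 2"
    using order_tendstoD(2)[of _ 0 sequentially "e / 2"] e eventually_sequentially by fastforce
  have clH: "(\<lambda>x. cl M (H n x)) absolutely_integrable_on {a..b}" for n
    by (intro absolutely_integrable_continuous_real cl_cont continuous_on_subset[OF H]) auto
  have "(\<lambda>n. integral {a..b} (\<lambda>x. \<bar>cl M (g x) - cl M (H n x)\<bar>)) \<longlonglongrightarrow> 0"
  proof (rule dominated_convergence_ae_zero[where h = "\<lambda>x. 2 * real M", OF _ _ _ N])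
    fix x assume x: "x \<in> {a..b} - N"
    have "(\<lambda>n. \<bar>g x - H n x\<bar>) \<longlonglongrightarrow> \<bar>g x - g x\<bar>"
      using lim[of x] x by (intro tendsto_intros) auto
    then have "(\<lambda>n. \<bar>g x - H n x\<bar>) \<longlonglongrightarrow> 0" by simp
    then show "(\<lambda>n. \<bar>cl M (g x) - cl M (H n x)\<bar>) \<longlonglongrightarrow> 0"
      by (rule Lim_null_comparison[rotated]) (use cl_lip in auto)
  next
    show "\<bar>\<bar>cl M (g x) - cl M (H k x)\<bar>\<bar> \<le> 2 * real M" for k x
      using cl_bd[of M "g x"] cl_bd[of M "H k x"] by linarith
  qed (use absint[OF cl_int clH] in auto)
  then obtain n where n: "integral {a..b} (\<lambda>x. \<bar>cl M (g x) - cl M (H n x)\<bar>) < e / 2"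
    using order_tendstoD(2)[of _ 0 sequentially "e / 2"] e eventually_sequentially by fastforce
  have "integral {a..b} (\<lambda>x. \<bar>g x - cl M (H n x)\<bar>)
      \<le> integral {a..b} (\<lambda>x. \<bar>g x - cl M (g x)\<bar> + \<bar>cl M (g x) - cl M (H n x)\<bar>)"
    by (intro integral_le absint g clH integrable_add cl_int) auto
  also have "\<dots> = integral {a..b} (\<lambda>x. \<bar>g x - cl M (g x)\<bar>)
      + integral {a..b} (\<lambda>x. \<bar>cl M (g x) - cl M (H n x)\<bar>)"
    by (intro Henstock_Kurzweil_Integration.integral_add absint g clH cl_int)
  also have "\<dots> < e" using M n by simp
  finally show ?thesis
    using that[of "\<lambda>x. cl M (H n x)"] cl_cont[OF H] by blast
qed

section \<open>Moments of the binomial filter\<close>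

text \<open>The sum is the \<open>p\<close>-th finite difference of \<open>x^i\<close> at
  \<open>0\<close>. For \<open>i = Suc j\<close> the absorption identity
  \<open>(l+1) * (p+1 choose l+1) = (p+1) * (p choose l)\<close> lowers \<open>p\<close>; expanding
  \<open>(l+1)^j\<close> leaves moments of order at most \<open>j\<close>, of which only the one of
  order \<open>p\<close> survives, and it occurs only when \<open>j = p\<close>.\<close>

lemma sum_binomial_alternating_power:
  "i \<le> p \<Longrightarrow> (\<Sum>l=0..p. real l ^ i * ((- 1) ^ (p - l) * real (p choose l))) = (if i = p then fact p else 0)"
proof (induction p arbitrary: i)
  case 0
  then show ?case by simp
next
  case (Suc p)
  let ?b = "\<lambda>p l. (- 1) ^ (p - l) * real (p choose l)"
  show ?case
  proof (cases i)
    case 0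
    have "(\<Sum>l\<le>Suc p. real (Suc p choose l) * 1 ^ l * (- 1) ^ (Suc p - l)) = (1 + (- 1)) ^ Suc p"
      by (rule binomial_ring[symmetric])
    then show ?thesis using 0 by (simp add: atLeast0AtMost mult.commute del: sum.atMost_Suc)
  next
    case (Suc j)
    have j: "j \<le> p" using Suc Suc.prems by simp
    have "(\<Sum>l=0..Suc p. real l ^ i * ?b (Suc p) l)
        = (\<Sum>l=0..p. real (Suc l) ^ i * ?b (Suc p) (Suc l))"
      using Suc by (simp add: sum.atLeast0_atMost_Suc_shift del: sum.cl_ivl_Suc)
    also have "\<dots> = (\<Sum>l=0..p. (real l + 1) ^ j * (real (Suc p) * ?b p l))"
    proof (rule sum.cong[OF refl])
      fix l
      have "real (Suc l) * real (Suc p choose Suc l) = real (Suc p) * real (p choose l)"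
        using Suc_times_binomial_eq[of p l] by (metis mult.commute of_nat_mult)
      then have "(- 1) ^ (p - l) * real (Suc l) ^ j * (real (Suc l) * real (Suc p choose Suc l))
          = (- 1) ^ (p - l) * real (Suc l) ^ j * (real (Suc p) * real (p choose l))"
        by (rule arg_cong)
      then show "real (Suc l) ^ i * ?b (Suc p) (Suc l) = (real l + 1) ^ j * (real (Suc p) * ?b p l)"
        using Suc by (simp add: mult_ac add.commute del: binomial_Suc_Suc)
    qed
    also have "\<dots> = (\<Sum>l=0..p. \<Sum>m\<le>j. real (Suc p) * real (j choose m) * (real l ^ m * ?b p l))"
      by (simp add: binomial_ring sum_distrib_left sum_distrib_right mult_ac)
    also have "\<dots> = (\<Sum>m\<le>j. real (Suc p) * real (j choose m) * (\<Sum>l=0..p. real l ^ m * ?b p l))"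
      by (subst sum.swap) (simp add: sum_distrib_left)
    also have "\<dots> = (\<Sum>m\<le>j. real (Suc p) * real (j choose m) * (if m = p then fact p else 0))"
      using Suc.IH j by (intro sum.cong) auto
    also have "\<dots> = (\<Sum>m\<le>j. if m = p then real (Suc p) * real (j choose p) * fact p else 0)"
      by (intro sum.cong) auto
    also have "\<dots> = (if i = Suc p then fact (Suc p) else 0)"
      using j Suc by (auto simp: sum.delta)
    finally show ?thesis .
  qed
qed

lemma binomial_filter_in_filters: "binomial_filter p \<in> filters p p"
  by (simp add: filters_def binomial_filter_def sum_binomial_alternating_power)

section \<open>A Taylor estimate with a free top coefficient\<close>

text \<open>\<open>F m\<close> need not be differentiable, so the term with coefficient
  \<open>v\<close> cannot come from Taylor's theorem for \<open>F 0\<close>. It is subtracted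
  beforehand, together with the term of degree \<open>m\<close>: the \<open>m\<close>-th derivative
  of the difference is then exactly the quantity bounded by \<open>B\<close>.\<close>

lemma taylor_top_derivative_approx:
  fixes F :: "nat \<Rightarrow> real \<Rightarrow> real"
  assumes S: "convex S" and w: "w \<in> S" and z: "z \<in> S"
    and F: "\<And>i x. i < m \<Longrightarrow> x \<in> S \<Longrightarrow> (F i has_field_derivative F (Suc i) x) (at x within S)"
    and B: "\<And>x. x \<in> S \<Longrightarrow> \<bar>F m x - F m w - v * (x - w)\<bar> \<le> B"
  shows "\<bar>F 0 z - (\<Sum>i\<le>m. F i w * (z - w) ^ i / fact i) - v * (z - w) ^ Suc m / fact (Suc m)\<bar>
    \<le> B * \<bar>z - w\<bar> ^ m"
proof (cases m)
  case 0
  then show ?thesis using B[OF z] by simp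
next
  case (Suc n)
  define T where "T = (\<lambda>k x. (x - w) ^ k / fact k :: real)"
  have T: "(T (Suc k) has_field_derivative T k x) (at x within S)" for k x
  proof -
    have "(T (Suc k) has_field_derivative real (Suc k) * (x - w) ^ k / fact (Suc k)) (at x within S)"
      unfolding T_def by (rule derivative_eq_intros refl | simp)+
    then show ?thesis by (simp add: T_def fact_Suc del: of_nat_Suc)
  qed
  have T0: "T 0 = (\<lambda>x. 1)" and Tw: "T (Suc k) w = 0" and T1: "T (Suc 0) x = x - w" for k x
    by (simp_all add: T_def)
  define E where "E = (\<lambda>i x. F i x - F m w * T (m - i) x - v * T (Suc m - i) x)"
  have "norm (E 0 z - (\<Sum>i\<le>n. E i w * (z - w) ^ i / fact i)) \<le> B * norm (z - w) ^ Suc n / fact n"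
  proof (rule field_Taylor[OF S _ _ w z])
    fix i x assume x: "x \<in> S" and i: "i \<le> n"
    have "(T (Suc (n - i)) has_field_derivative T (n - i) x) (at x within S)"
      "(T (Suc (m - i)) has_field_derivative T (m - i) x) (at x within S)"
      by (rule T)+
    moreover have "Suc (n - i) = m - i" "Suc (m - i) = Suc m - i" "n - i = m - Suc i" "m - i = Suc m - Suc i"
      using i Suc by auto
    ultimately have "(T (m - i) has_field_derivative T (m - Suc i) x) (at x within S)"
      "(T (Suc m - i) has_field_derivative T (Suc m - Suc i) x) (at x within S)"
      by metis+
    then show "(E i has_field_derivative E (Suc i) x) (at x within S)"
      unfolding E_def using F[of i x] x i Suc by (auto intro!: derivative_eq_intros)
  next
    fix x assume "x \<in> S"
    then show "norm (E (Suc n) x) \<le> B"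
      using B[of x] Suc by (simp add: E_def T0 T1)
  qed
  \<comment> \<open>Here \<open>m - i\<close> and \<open>Suc m - i\<close> are positive, so the
    subtracted monomials vanish at \<open>w\<close> and the lower Taylor coefficients remain those
    of \<open>F\<close>.\<close>
  moreover have "E i w = F i w" if "i \<le> n" for i
    using that Suc Tw[of "n - i"] Tw[of "m - i"] by (simp add: E_def Suc_diff_le)
  then have "(\<Sum>i\<le>n. E i w * (z - w) ^ i / fact i) = (\<Sum>i\<le>n. F i w * (z - w) ^ i / fact i)"
    by (intro sum.cong) auto
  moreover have "E 0 z = F 0 z - F m w * (z - w) ^ m / fact m - v * (z - w) ^ Suc m / fact (Suc m)"
    by (simp only: E_def T_def diff_zero times_divide_eq_right)
  moreover have "(\<Sum>i\<le>m. F i w * (z - w) ^ i / fact i)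
      = (\<Sum>i\<le>n. F i w * (z - w) ^ i / fact i) + F m w * (z - w) ^ m / fact m"
    by (simp only: Suc sum.atMost_Suc)
  ultimately have "\<bar>F 0 z - (\<Sum>i\<le>m. F i w * (z - w) ^ i / fact i) - v * (z - w) ^ Suc m / fact (Suc m)\<bar>
      \<le> B * \<bar>z - w\<bar> ^ m / fact n"
    unfolding real_norm_def Suc[symmetric] by (simp only: diff_diff_eq add.assoc add.commute add.left_commute)
  also have "B \<ge> 0" using B[OF w] by simp
  then have "B * \<bar>z - w\<bar> ^ m / fact n \<le> B * \<bar>z - w\<bar> ^ m / 1"
    by (intro divide_left_mono) (auto simp: fact_ge_1)
  finally show ?thesis by simp
qed

section \<open>Overlapping windows on the grid\<close>

lemma grid_interval_subset_unit:
  "n > 0 \<Longrightarrow> j \<le> n \<Longrightarrow> {real i / real n..real j / real n} \<subseteq> {0..1}"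
  by simp

text \<open>Each grid cell lies in at most \<open>m\<close> windows. The induction strips the last
  cell of every window: since \<open>k + m\<close> determines \<open>k\<close>, these cells are
  distinct and together cost at most one integral over \<open>{0..1}\<close>.\<close>

lemma sum_integral_windows_le:
  fixes u :: "real \<Rightarrow> real"
  assumes u: "u integrable_on {0..1}" and nonneg: "\<And>x. x \<in> {0..1} \<Longrightarrow> 0 \<le> u x" and n: "n > 0"
    and B: "B \<subseteq> {k. k + m \<le> n}"
  shows "(\<Sum>k\<in>B. integral {real k / real n..real (k + m) / real n} u) \<le> real m * integral {0..1} u"
  using B
proof (induction m)
  case 0
  then show ?case by simp
next
  case (Suc m)
  let ?I = "\<lambda>i j. integral {real i / real n..real j / real n} u"
  have int: "u integrable_on {real i / real n..real j / real n}" if "j \<le> n" for i j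
    by (rule integrable_on_subinterval[OF u grid_interval_subset_unit[OF n that]])
  have split: "?I i j + ?I j k = ?I i k" if "i \<le> j" "j \<le> k" "k \<le> n" for i j k
    using that n by (intro Henstock_Kurzweil_Integration.integral_combine int) (auto simp: divide_simps)
  have pos: "0 \<le> ?I i j" if "j \<le> n" for i j
    using grid_interval_subset_unit[OF n that, of i] by (intro integral_nonneg int nonneg that) blast
  have cells: "(\<Sum>i<r. ?I i (Suc i)) = ?I 0 r" if "r \<le> n" for r
    using that
  proof (induction r)
    case (Suc r)
    then show ?case using split[of 0 r "Suc r"] by simp
  qed simp
  have fin: "finite B"
    using Suc.prems by (rule finite_subset[OF _ finite_subset[OF _ finite_atMost[of n]]]) auto
  have "(\<Sum>k\<in>B. ?I k (k + Suc m)) = (\<Sum>k\<in>B. ?I k (k + m) + ?I (k + m) (Suc (k + m)))"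
  proof (rule sum.cong[OF refl])
    fix k assume "k \<in> B"
    then have "Suc (k + m) \<le> n" using Suc.prems by auto
    then show "?I k (k + Suc m) = ?I k (k + m) + ?I (k + m) (Suc (k + m))"
      using split[of k "k + m" "Suc (k + m)"] by simp
  qed
  also have "\<dots> = (\<Sum>k\<in>B. ?I k (k + m)) + (\<Sum>i\<in>(\<lambda>k. k + m) ` B. ?I i (Suc i))"
    by (simp add: sum.distrib sum.reindex)
  also have "(\<Sum>i\<in>(\<lambda>k. k + m) ` B. ?I i (Suc i)) \<le> (\<Sum>i<n. ?I i (Suc i))"
    using Suc.prems by (intro sum_mono2 pos) auto
  also have "\<dots> = integral {0..1} u"
    using cells[of n] n by simp
  also have "(\<Sum>k\<in>B. ?I k (k + m)) \<le> real m * integral {0..1} u"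
    using Suc.prems by (intro Suc.IH) auto
  finally show ?case by (simp add: algebra_simps)
qed

text \<open>With \<open>v = h (k / n)\<close> the bound controls \<open>|v|\<close>, and hence the
  integral of \<open>|g|\<close> over the window, by the \<open>L^1\<close> error and the
  oscillation of \<open>h\<close>. The order of choice is \<open>N\<close>, then \<open>d\<close>
  and \<open>h\<close>, then \<open>n\<close>.\<close>

lemma card_oscillation_windows_density_zero:
  fixes g :: "real \<Rightarrow> real"
  assumes g: "g absolutely_integrable_on {0..1}"
    and ne: "AE x in lebesgue. x \<in> {0..1} \<longrightarrow> g x \<noteq> 0"
    and m: "m \<ge> 1" and C: "C \<ge> 0"
    and B: "\<And>n. B n \<subseteq> {k. k + m \<le> n}"
    and bound: "\<And>n k v. k \<in> B n \<Longrightarrow>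
      \<bar>v\<bar> \<le> C * real n * integral {real k / real n..real (k + m) / real n} (\<lambda>x. \<bar>g x - v\<bar>)"
  shows "(\<lambda>n. real (card (B n)) / real n) \<longlonglongrightarrow> 0"
proof (rule LIMSEQ_I)
  fix e :: real assume e: "e > 0"
  have m0: "real m \<ge> 1" using m by simp
  have absint: "(\<lambda>x. \<bar>w x\<bar>) absolutely_integrable_on {0..1}" if "w absolutely_integrable_on {0..1}" for w :: "real \<Rightarrow> real"
    by (rule set_integrable_abs[OF that])
  have const: "(\<lambda>x::real. c) absolutely_integrable_on {0..1}" for c :: real
    by (rule absolutely_integrable_continuous_real) auto
  \<comment> \<open>\<open>1 \<le> u N + N \<bar>g\<bar>\<close> pointwise, so windows where \<open>\<bar>g\<bar>\<close> has small integral are few\<close>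
  define u where "u N x = 1 - min 1 (real N * \<bar>g x\<bar>)" for N x
  have u_int: "u N absolutely_integrable_on {0..1}" for N
    unfolding u_def
    by (intro set_integral_diff(1) absolutely_integrable_min_1 set_integrable_mult_right absint g const)
  have u_pos: "0 \<le> u N x" for N x by (simp add: u_def)
  \<comment> \<open>\<open>u N x\<close> is \<open>0\<close> as soon as
    \<open>N \<ge> 1 / |g x|\<close>, so only the zeros of \<open>g\<close> obstruct convergence;
    the almost everywhere hypothesis enters here.\<close>
  have "(\<lambda>N. integral {0..1} (u N)) \<longlonglongrightarrow> 0"
  proof (rule dominated_convergence_ae_zero)
    show "negligible {x \<in> {0..1}. g x = 0}"
    proof -
      obtain Z where Z: "Z \<in> null_sets lebesgue"
        and sub: "{x \<in> space lebesgue. \<not> (x \<in> {0..1} \<longrightarrow> g x \<noteq> 0)} \<subseteq> Z"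
        using ne unfolding eventually_ae_filter by blast
      have "negligible Z" using Z by (simp only: negligible_iff_null_sets)
      then show ?thesis
        by (rule negligible_subset) (use sub in auto)
    qed
    show "u k integrable_on {0..1}" for k
      using u_int set_lebesgue_integral_eq_integral(1) by blast
    show "(\<lambda>x::real. 1::real) integrable_on {0..1}" by auto
    show "\<bar>u k x\<bar> \<le> 1" for k x by (simp add: u_def min_def)
    show "(\<lambda>k. u k x) \<longlonglongrightarrow> 0" if "x \<in> {0..1} - {x \<in> {0..1}. g x = 0}" for x
    proof -
      have gx: "\<bar>g x\<bar> > 0" using that by auto
      obtain N0 where N0: "1 / \<bar>g x\<bar> \<le> real N0" using real_arch_simple by blast
      have "u N x = 0" if "N \<ge> N0" for N
      proof -
        have "1 / \<bar>g x\<bar> \<le> real N" using N0 that by linarith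
        then show ?thesis using gx by (simp add: u_def min_def field_simps)
      qed
      then show ?thesis by (intro tendsto_eventually eventually_sequentiallyI[of N0]) auto
    qed
  qed
  then obtain N where N: "integral {0..1} (u N) < e / (2 * real m)"
    using order_tendstoD(2)[of _ 0 sequentially "e / (2 * real m)"] e m0 eventually_sequentially by fastforce
  \<comment> \<open>Chosen so that \<open>(N + 1) * (1 + C * m) * (2 * m * d) = e / 2\<close>: one
    \<open>m * d\<close> pays for the \<open>L^1\<close> error of \<open>h\<close>, the other for
    its oscillation on the windows. \<open>N + 1\<close> keeps the denominator positive when
    \<open>N = 0\<close>.\<close>
  define d where "d = e / (4 * (real N + 1) * real m * (1 + C * real m))"
  have pos: "real N + 1 > 0" "1 + C * real m > 0" "real m > 0"
    using C m0 by (auto intro: add_pos_nonneg)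
  have d: "d > 0" unfolding d_def using e pos by (intro divide_pos_pos mult_pos_pos) auto
  obtain h where h: "continuous_on UNIV h" and hg: "integral {0..1} (\<lambda>x. \<bar>g x - h x\<bar>) < d"
    using absolutely_integrable_approximate_continuous[OF g d] by blast
  have h01: "continuous_on {0..1} h" using h continuous_on_subset by blast
  obtain \<delta> where \<delta>: "\<delta> > 0" and unif: "\<And>x y. x \<in> {0..1} \<Longrightarrow> y \<in> {0..1} \<Longrightarrow> \<bar>x - y\<bar> < \<delta> \<Longrightarrow> \<bar>h x - h y\<bar> < d"
    using compact_uniformly_continuous[OF h01] d unfolding uniformly_continuous_on_def dist_real_def
    by (metis compact_Icc)
  obtain n0 where n0: "real m / \<delta> < real n0" using reals_Archimedean2 by blast
  have "\<bar>real (card (B n)) / real n\<bar> < e" if n: "n \<ge> Suc n0" for n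
  proof -
    have npos: "real n > 0" using n by simp
    have "real m / \<delta> < real n" using n0 n by linarith
    then have mn: "real m / real n < \<delta>" using \<delta> npos by (simp add: field_simps)
    let ?W = "\<lambda>k. {real k / real n..real (k + m) / real n}"
    have each: "1 / real n \<le> integral (?W k) (u N)
        + real N * (1 + C * real m) * (integral (?W k) (\<lambda>x. \<bar>g x - h x\<bar>) + d * (real m / real n))"
      if k: "k \<in> B n" for k
    proof -
      have W: "?W k \<subseteq> {0..1}"
        using B[of n] k npos by (intro grid_interval_subset_unit) auto
      have int: "w integrable_on ?W k" if "w absolutely_integrable_on {0..1}" for w :: "real \<Rightarrow> real"
        using absolutely_integrable_on_subinterval[OF that W] set_lebesgue_integral_eq_integral(1) by blast
      have len: "integral (?W k) (\<lambda>x::real. c) = c * (real m / real n)" for c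
        using npos by (simp add: divide_simps)
      define v where "v = h (real k / real n)"
      define J where "J = integral (?W k) (\<lambda>x. \<bar>g x - h x\<bar>) + d * (real m / real n)"
      have gh: "(\<lambda>x. \<bar>g x - h x\<bar>) absolutely_integrable_on {0..1}"
        by (intro absint set_integral_diff(1) g absolutely_integrable_continuous_real h01)
      have gv: "(\<lambda>x. \<bar>g x - v\<bar>) absolutely_integrable_on {0..1}"
        by (intro absint set_integral_diff(1) g const)
      have "integral (?W k) (\<lambda>x. \<bar>g x - v\<bar>) \<le> integral (?W k) (\<lambda>x. \<bar>g x - h x\<bar> + d)"
      proof (intro integral_le int gv set_integral_add(1) gh const)
        fix x assume x: "x \<in> ?W k"
        have "\<bar>x - real k / real n\<bar> \<le> real m / real n"
          using x by (auto simp: add_divide_distrib)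
        moreover have "real k / real n \<in> ?W k" using npos by (simp add: divide_simps)
        ultimately have "\<bar>h x - v\<bar> < d"
          unfolding v_def using unif[OF subsetD[OF W] subsetD[OF W]] x mn by (meson le_less_trans)
        then show "\<bar>g x - v\<bar> \<le> \<bar>g x - h x\<bar> + d" by linarith
      qed
      also have "\<dots> = J"
        unfolding J_def Henstock_Kurzweil_Integration.integral_add[OF int[OF gh] int[OF const]] len ..
      finally have gvJ: "integral (?W k) (\<lambda>x. \<bar>g x - v\<bar>) \<le> J" .
      \<comment> \<open>Multiplying by the window length \<open>m / n\<close> cancels the factor
        \<open>n\<close> in \<open>bound\<close>; the left side is the integral of the constant
        \<open>|v|\<close> over the window.\<close>
      have "\<bar>v\<bar> * (real m / real n)
          \<le> C * real n * integral (?W k) (\<lambda>x. \<bar>g x - v\<bar>) * (real m / real n)"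
        using bound[OF k, of v] by (rule mult_right_mono) simp
      also have "\<dots> = C * real m * integral (?W k) (\<lambda>x. \<bar>g x - v\<bar>)" using npos by simp
      also have "\<dots> \<le> C * real m * J" using gvJ C by (intro mult_left_mono) auto
      finally have v: "\<bar>v\<bar> * (real m / real n) \<le> C * real m * J" .
      have "integral (?W k) (\<lambda>x. \<bar>g x\<bar>) \<le> integral (?W k) (\<lambda>x. \<bar>g x - v\<bar> + \<bar>v\<bar>)"
        by (intro integral_le int absint g gv set_integral_add(1) const) auto
      also have "\<dots> = integral (?W k) (\<lambda>x. \<bar>g x - v\<bar>) + \<bar>v\<bar> * (real m / real n)"
        unfolding Henstock_Kurzweil_Integration.integral_add[OF int[OF gv] int[OF const]] len ..
      also have "\<dots> \<le> (1 + C * real m) * J" using gvJ v by (simp add: algebra_simps)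
      finally have gJ: "integral (?W k) (\<lambda>x. \<bar>g x\<bar>) \<le> (1 + C * real m) * J" .
      \<comment> \<open>Only \<open>1 / n\<close> of the length \<open>m / n\<close> is kept, so
        that summing over \<open>B n\<close> produces \<open>card (B n) / n\<close>.\<close>
      have "1 / real n \<le> integral (?W k) (\<lambda>x. 1)"
        unfolding len using m0 npos by (simp add: divide_simps)
      also have "\<dots> \<le> integral (?W k) (\<lambda>x. u N x + real N * \<bar>g x\<bar>)"
        by (intro integral_le int set_integral_add(1) u_int set_integrable_mult_right absint g const)
          (auto simp: u_def min_def)
      also have "\<dots> = integral (?W k) (u N) + real N * integral (?W k) (\<lambda>x. \<bar>g x\<bar>)"
        unfolding Henstock_Kurzweil_Integration.integral_add[OF int[OF u_int]
            int[OF set_integrable_mult_right[OF absint[OF g]]]] by simp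
      also have "\<dots> \<le> integral (?W k) (u N) + real N * ((1 + C * real m) * J)"
        using gJ by (intro add_left_mono mult_left_mono) auto
      finally show ?thesis by (simp add: J_def mult.assoc)
    qed
    have fin: "finite (B n)" and cardB: "card (B n) \<le> n"
    proof -
      have "B n \<subseteq> {..<n}" using B[of n] m by auto
      then show "finite (B n)" "card (B n) \<le> n"
        using finite_subset card_mono[of "{..<n}" "B n"] by auto
    qed
    let ?G = "integral {0..1} (\<lambda>x. \<bar>g x - h x\<bar>)"
    have gh: "(\<lambda>x. \<bar>g x - h x\<bar>) integrable_on {0..1}"
      by (intro set_lebesgue_integral_eq_integral(1) absint set_integral_diff(1) g
          absolutely_integrable_continuous_real h01)
    have "real (card (B n)) / real n = (\<Sum>k\<in>B n. 1 / real n)" by simp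
    also have "\<dots> \<le> (\<Sum>k\<in>B n. integral (?W k) (u N)
        + real N * (1 + C * real m) * (integral (?W k) (\<lambda>x. \<bar>g x - h x\<bar>) + d * (real m / real n)))"
      by (rule sum_mono[OF each])
    also have "\<dots> = (\<Sum>k\<in>B n. integral (?W k) (u N)) + real N * (1 + C * real m) *
        ((\<Sum>k\<in>B n. integral (?W k) (\<lambda>x. \<bar>g x - h x\<bar>)) + real (card (B n)) * (d * (real m / real n)))"
      by (simp only: sum.distrib sum_distrib_left[symmetric] sum_constant mult.left_commute[of "real (card (B n))"])
    \<comment> \<open>The overlap estimate gives the factor \<open>m\<close> on both integrals; the
      constant term uses \<open>card (B n) \<le> n\<close>.\<close>
    also have "\<dots> \<le> real m * integral {0..1} (u N) + real N * (1 + C * real m) *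
        (real m * ?G + d * real m)"
    proof (intro add_mono mult_left_mono sum_integral_windows_le[OF _ _ _ B] gh)
      show "u N integrable_on {0..1}" using u_int set_lebesgue_integral_eq_integral(1) by blast
      have "real (card (B n)) * (d * (real m / real n)) = (real (card (B n)) / real n) * (d * real m)" by simp
      also have "\<dots> \<le> 1 * (d * real m)"
        using cardB npos d by (intro mult_right_mono) auto
      finally show "real (card (B n)) * (d * (real m / real n)) \<le> d * real m" by simp
    qed (use npos u_pos C in auto)
    also have "\<dots> \<le> real m * integral {0..1} (u N) + real N * (1 + C * real m) * (real m * d + d * real m)"
      using hg C by (intro add_left_mono mult_left_mono add_right_mono) auto
    also have "\<dots> < real m * (e / (2 * real m)) + (real N + 1) * (1 + C * real m) * (2 * real m * d)"
    proof (rule add_less_le_mono)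
      show "real m * integral {0..1} (u N) < real m * (e / (2 * real m))"
        using N m0 by (intro mult_strict_left_mono) auto
      show "real N * (1 + C * real m) * (real m * d + d * real m)
          \<le> (real N + 1) * (1 + C * real m) * (2 * real m * d)"
        using C d by (intro mult_mono) auto
    qed
    also have "\<dots> = e"
    proof -
      have "x * y * (2 * z * (e / (4 * x * z * y))) = e / 2" if "x > 0" "y > 0" "z > 0" for x y z :: real
        using that by (simp add: field_simps)
      then have "(real N + 1) * (1 + C * real m) * (2 * real m * d) = e / 2"
        unfolding d_def using pos by blast
      then show ?thesis using pos by simp
    qed
    finally show ?thesis by simp
  qed
  then show "\<exists>no. \<forall>n\<ge>no. norm (real (card (B n)) / real n - 0) < e" by auto
qed

section \<open>Expansion of the increments\<close>

text \<open>The vanishing moments kill the Taylor polynomial \<open>P\<close> of degree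
  \<open>m\<close>, and the subtracted term \<open>Q\<close> of degree \<open>Suc m\<close>
  contributes exactly the multiple of \<open>v\<close>. As \<open>v\<close> is arbitrary, it can be
  adapted to each window later.\<close>

lemma gen_increment_approx:
  fixes F :: "nat \<Rightarrow> real \<Rightarrow> real"
  assumes a: "a \<in> filters (Suc m) q"
    and F: "\<And>i x. i < m \<Longrightarrow> x \<in> {0..1} \<Longrightarrow> (F i has_field_derivative F (Suc i) x) (at x within {0..1})"
    and g: "g absolutely_integrable_on {0..1}"
    and Fg: "\<And>x y. 0 \<le> x \<Longrightarrow> x \<le> y \<Longrightarrow> y \<le> 1 \<Longrightarrow> F m y - F m x = integral {x..y} g"
    and n: "n > 0" and jn: "j + q \<le> n"
  shows "\<bar>real n ^ Suc m * gen_increment q a n j (F 0) - v * ((\<Sum>l=0..q. real l ^ Suc m * a l) / fact (Suc m))\<bar>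
    \<le> (\<Sum>l=0..q. \<bar>a l\<bar>) * real q ^ m * real n *
      integral {real j / real n..real (j + q) / real n} (\<lambda>x. \<bar>g x - v\<bar>)"
proof -
  define w where "w = real j / real n"
  define z where "z l = real (j + l) / real n" for l
  define S where "S = {w..z q}"
  define I where "I = integral S (\<lambda>x. \<bar>g x - v\<bar>)"
  define P where "P l = (\<Sum>i\<le>m. F i w * (z l - w) ^ i / fact i)" for l
  define Q where "Q l = v * (z l - w) ^ Suc m / fact (Suc m)" for l
  have npos: "real n > 0" using n by simp
  have zw: "z l - w = real l / real n" for l by (simp add: z_def w_def add_divide_distrib)
  have S01: "S \<subseteq> {0..1}"
    unfolding S_def w_def z_def by (rule grid_interval_subset_unit[OF n jn])
  have zS: "z l \<in> S" if "l \<le> q" for l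
    using that npos by (simp add: S_def z_def w_def divide_right_mono)
  have wS: "w \<in> S" using zS[of 0] by (simp add: z_def w_def)
  have gS: "(\<lambda>x. g x - v) absolutely_integrable_on {s..t}" if "{s..t} \<subseteq> {0..1}" for s t
    by (intro set_integral_diff(1) absolutely_integrable_on_subinterval[OF g that]
        absolutely_integrable_continuous_real continuous_intros)
  have gvS: "(\<lambda>x. \<bar>g x - v\<bar>) integrable_on {s..t}" if "{s..t} \<subseteq> {0..1}" for s t
    using set_integrable_abs[OF gS[OF that]] set_lebesgue_integral_eq_integral(1) by blast
  \<comment> \<open>The error in the top derivative is the integral of \<open>g - v\<close> from
    \<open>w\<close> to \<open>x\<close>, so the single number \<open>I\<close> serves as the Taylor
    bound on the whole window.\<close>
  have osc: "\<bar>F m x - F m w - v * (x - w)\<bar> \<le> I" if x: "x \<in> S" for x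
  proof -
    have sub: "{w..x} \<subseteq> {0..1}" "{w..x} \<subseteq> S" using S01 x wS by (auto simp: S_def)
    have "g integrable_on {w..x}"
      using absolutely_integrable_on_subinterval[OF g sub(1)] set_lebesgue_integral_eq_integral(1) by blast
    moreover have "0 \<le> w" "w \<le> x" "x \<le> 1" using S01 x wS by (auto simp: S_def)
    ultimately have "F m x - F m w - v * (x - w) = integral {w..x} (\<lambda>x. g x - v)"
      using Fg[of w x] by (subst Henstock_Kurzweil_Integration.integral_diff) (auto simp: mult.commute)
    also have "\<bar>\<dots>\<bar> \<le> integral {w..x} (\<lambda>x. \<bar>g x - v\<bar>)"
      using Henstock_Kurzweil_Integration.integral_norm_bound_integral[OF
          set_lebesgue_integral_eq_integral(1)[OF gS] gvS, OF sub(1) sub(1)] by simp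
    also have "\<dots> \<le> I"
      unfolding I_def using S01 gvS
      by (intro integral_subset_le sub gvS) (auto simp: S_def)
    finally show ?thesis .
  qed
  have I0: "I \<ge> 0" using osc[OF wS] by simp
  have rem: "\<bar>F 0 (z l) - P l - Q l\<bar> \<le> I * (real q / real n) ^ m" if l: "l \<le> q" for l
  proof -
    have "\<bar>F 0 (z l) - P l - Q l\<bar> \<le> I * \<bar>z l - w\<bar> ^ m"
      unfolding P_def Q_def
    proof (rule taylor_top_derivative_approx[where S = S])
      show "convex S" by (simp add: S_def)
      show "(F i has_field_derivative F (Suc i) x) (at x within S)" if "i < m" "x \<in> S" for i x
        using F[of i x] that S01 has_field_derivative_subset by blast
    qed (use wS zS[OF l] osc in auto)
    also have "\<dots> \<le> I * (real q / real n) ^ m"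
      unfolding zw using l I0 npos by (intro mult_left_mono power_mono) (auto simp: divide_right_mono)
    finally show ?thesis .
  qed
  have mom: "(\<Sum>l=0..q. a l * (z l - w) ^ i) = (\<Sum>l=0..q. real l ^ i * a l) / real n ^ i" for i
    by (simp add: zw power_divide sum_divide_distrib mult.commute)
  have "(\<Sum>l=0..q. a l * P l) = (\<Sum>i\<le>m. F i w / fact i * (\<Sum>l=0..q. a l * (z l - w) ^ i))"
    unfolding P_def sum_distrib_left by (subst sum.swap) (simp add: mult_ac)
  also have "\<dots> = 0"
    using a by (intro sum.neutral) (auto simp: mom filters_def)
  finally have P0: "(\<Sum>l=0..q. a l * P l) = 0" .
  have "(\<Sum>l=0..q. a l * Q l) = v / fact (Suc m) * (\<Sum>l=0..q. a l * (z l - w) ^ Suc m)"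
    unfolding Q_def sum_distrib_left by (intro sum.cong) auto
  then have Q: "real n ^ Suc m * (\<Sum>l=0..q. a l * Q l) = v * ((\<Sum>l=0..q. real l ^ Suc m * a l) / fact (Suc m))"
    unfolding mom using npos by simp
  have "gen_increment q a n j (F 0) - (\<Sum>l=0..q. a l * Q l) = (\<Sum>l=0..q. a l * (F 0 (z l) - P l - Q l))"
    using P0 by (simp add: gen_increment_def z_def right_diff_distrib sum_subtractf)
  also have "\<bar>\<dots>\<bar> \<le> (\<Sum>l=0..q. \<bar>a l\<bar> * (I * (real q / real n) ^ m))"
    by (rule order_trans[OF sum_abs])
      (auto simp: abs_mult intro!: sum_mono mult_left_mono rem)
  finally have "real n ^ Suc m * \<bar>gen_increment q a n j (F 0) - (\<Sum>l=0..q. a l * Q l)\<bar>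
      \<le> real n ^ Suc m * ((\<Sum>l=0..q. \<bar>a l\<bar>) * (I * (real q / real n) ^ m))"
    by (intro mult_left_mono) (auto simp: sum_distrib_right)
  \<comment> \<open>\<open>n ^ Suc m\<close> against \<open>(q / n) ^ m\<close> leaves one factor
    \<open>n\<close>, which turns \<open>I\<close> into a multiple of the mean of
    \<open>|g - v|\<close> over the window.\<close>
  also have "\<dots> = (\<Sum>l=0..q. \<bar>a l\<bar>) * real q ^ m * real n * I"
    using npos by (simp add: power_divide)
  also have "real n ^ Suc m * \<bar>gen_increment q a n j (F 0) - (\<Sum>l=0..q. a l * Q l)\<bar>
      = \<bar>real n ^ Suc m * gen_increment q a n j (F 0) - v * ((\<Sum>l=0..q. real l ^ Suc m * a l) / fact (Suc m))\<bar>"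
    unfolding Q[symmetric] right_diff_distrib[symmetric] by (simp add: abs_mult)
  finally show ?thesis by (simp only: I_def S_def w_def z_def)
qed

section \<open>Sign changes and the increment ratio\<close>

text \<open>Otherwise both \<open>s\<close> and \<open>t\<close> would be closer to \<open>y\<close>
  than \<open>0\<close> is, and so both would have the sign of \<open>y\<close>.\<close>

lemma opposite_signs_imp_far:
  fixes s t y :: real
  assumes "s * t < 0"
  shows "\<bar>y\<bar> \<le> \<bar>s - y\<bar> \<or> \<bar>y\<bar> \<le> \<bar>t - y\<bar>"
  using assms unfolding mult_less_0_iff by linarith

text \<open>Without opposite signs the triangle inequality is an equality, and the convention for
  \<open>0 / 0\<close> covers two zero increments; with opposite signs the ratio still lies between
  \<open>0\<close> and \<open>1\<close>.\<close>

lemma ratio_conv_increments: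
  fixes x y :: real
  shows "\<bar>ratio_conv \<bar>x + y\<bar> (\<bar>x\<bar> + \<bar>y\<bar>) - 1\<bar> \<le> (if x * y < 0 then 1 else 0)"
proof (cases "x * y < 0")
  case True
  then have "x \<noteq> 0" by auto
  then have "\<bar>x\<bar> + \<bar>y\<bar> > 0" by linarith
  then show ?thesis using True abs_triangle_ineq[of x y]
    by (auto simp: ratio_conv_def abs_le_iff divide_simps)
next
  case False
  then have "\<bar>x + y\<bar> = \<bar>x\<bar> + \<bar>y\<bar>"
    by (auto simp: abs_if not_less zero_le_mult_iff)
  then show ?thesis using False by (simp add: ratio_conv_def)
qed

lemma increment_ratio_tendsto_1:
  assumes "(\<lambda>n. real (card {k. k < n - q \<and> gen_increment q a n k f * gen_increment q a n (k + 1) f < 0}) / real n)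
    \<longlonglongrightarrow> 0"
  shows "(\<lambda>n. increment_ratio q a n f) \<longlonglongrightarrow> 1"
proof -
  let ?d = "\<lambda>n k. gen_increment q a n k f"
  let ?B = "\<lambda>n. {k. k < n - q \<and> ?d n k * ?d n (k + 1) < 0}"
  \<comment> \<open>\<open>n \<ge> 2 * q + 1\<close> makes \<open>n - q\<close> positive and at
    least \<open>n / 2\<close>, so the normalisation \<open>n - q\<close> can be replaced by
    \<open>n\<close> at the cost of the factor \<open>2\<close>.\<close>
  have "norm (increment_ratio q a n f - 1) \<le> 2 * (real (card (?B n)) / real n)" if n: "n \<ge> 2 * q + 1" for n
  proof -
    let ?r = "\<lambda>k. ratio_conv \<bar>?d n k + ?d n (k + 1)\<bar> (\<bar>?d n k\<bar> + \<bar>?d n (k + 1)\<bar>)"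
    have N: "real (n - q) > 0" "real n \<le> 2 * real (n - q)" "real n > 0"
      using n by auto
    have "1 / real N * (\<Sum>k<N. ?r k) - 1 = 1 / real N * (\<Sum>k<N. ?r k - 1)" if "real N > 0" for N
      using that by (simp add: sum_subtractf right_diff_distrib)
    from this[OF N(1)]
    have "increment_ratio q a n f - 1 = 1 / real (n - q) * (\<Sum>k<n - q. ?r k - 1)"
      unfolding increment_ratio_def .
    then have "\<bar>increment_ratio q a n f - 1\<bar> = 1 / real (n - q) * \<bar>\<Sum>k<n - q. ?r k - 1\<bar>"
      by (simp add: abs_mult)
    also have "\<dots> \<le> 1 / real (n - q) * (\<Sum>k<n - q. if ?d n k * ?d n (k + 1) < 0 then 1 else 0)"
      by (intro mult_left_mono order_trans[OF sum_abs] sum_mono ratio_conv_increments) auto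
    also have "(\<Sum>k<n - q. if ?d n k * ?d n (k + 1) < 0 then 1 else 0 :: real) = real (card (?B n))"
      by (subst sum.inter_filter[symmetric]) (auto intro: arg_cong[where f = card])
    also have "1 / real (n - q) \<le> 2 / real n"
      using N by (simp add: field_simps)
    finally show ?thesis by (simp add: mult_right_mono)
  qed
  then have "(\<lambda>n. increment_ratio q a n f - 1) \<longlonglongrightarrow> 0"
    by (intro Lim_null_comparison[OF eventually_sequentiallyI tendsto_mult_right_zero[OF assms]])
  then show ?thesis using Lim_null by blast
qed

section \<open>Iterated derivatives and the convergence of the ratios\<close>

lemma times_cont_differentiable_on_has_field_derivative:
  assumes "times_cont_differentiable_on m f S" "i < m" "x \<in> S"
  shows "(higher_deriv_on S i f has_field_derivative higher_deriv_on S (Suc i) f x) (at x within S)"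
  using assms unfolding times_cont_differentiable_on_def differentiable_on_def
  by (auto simp: has_real_derivative_iff_has_vector_derivative vector_derivative_works)

theorem proposition2p1:
  fixes p :: nat and f g :: "real \<Rightarrow> real"
  assumes "p \<ge> 1"
    and "times_cont_differentiable_on (p - 1) f {0..1}"
    and "abs_continuous_on_interval (higher_deriv_on {0..1} (p - 1) f) 0 1"
    and "has_RN_derivative_on (higher_deriv_on {0..1} (p - 1) f) g 0 1"
    and "AE x in lebesgue. x \<in> {0..1} \<longrightarrow> g x \<noteq> 0"
  shows "(\<lambda>n. binomial_increment_ratio p n f) \<longlonglongrightarrow> 1
    \<and> (\<forall>q\<ge>p. \<forall>a\<in>filters p q. (\<lambda>n. increment_ratio q a n f) \<longlonglongrightarrow> 1)"
proof -
  obtain m where p: "p = Suc m" using assms(1) by (cases p) auto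
  define F where "F i = higher_deriv_on {0..1} i f" for i
  have g: "g absolutely_integrable_on {0..1}"
    using assms(4) by (simp add: has_RN_derivative_on_def)
  have F: "(F i has_field_derivative F (Suc i) x) (at x within {0..1})" if "i < m" "x \<in> {0..1}" for i x
    unfolding F_def using times_cont_differentiable_on_has_field_derivative[of m f "{0..1}"] assms(2) p that by simp
  have Fg: "F m y - F m x = integral {x..y} g" if "0 \<le> x" "x \<le> y" "y \<le> 1" for x y
  proof -
    have "g absolutely_integrable_on {x..y}"
      using that by (intro absolutely_integrable_on_subinterval[OF g]) auto
    then show ?thesis
      using assms(4) that p by (simp add: has_RN_derivative_on_def F_def set_lebesgue_integral_eq_integral(2))
  qed
  have main: "(\<lambda>n. increment_ratio q a n f) \<longlonglongrightarrow> 1" if a: "a \<in> filters p q" for q a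
  proof (rule increment_ratio_tendsto_1)
    \<comment> \<open>To leading order the increments are \<open>c * g / n^p\<close>;
      \<open>c\<close> is nonzero because the filter has nonvanishing moment of order
      \<open>p\<close>.\<close>
    define c where "c = (\<Sum>l=0..q. real l ^ Suc m * a l) / fact (Suc m)"
    define K where "K = (\<Sum>l=0..q. \<bar>a l\<bar>) * real q ^ m"
    have c0: "c \<noteq> 0" using a p by (simp add: c_def filters_def del: fact_Suc)
    have K0: "K \<ge> 0" by (simp add: K_def sum_nonneg)
    let ?d = "\<lambda>n k. gen_increment q a n k f"
    let ?I = "\<lambda>n i j v. integral {real i / real n..real j / real n} (\<lambda>x. \<bar>g x - v\<bar>)"
    show "(\<lambda>n. real (card {k. k < n - q \<and> ?d n k * ?d n (k + 1) < 0}) / real n) \<longlonglongrightarrow> 0"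
    \<comment> \<open>Increments \<open>k\<close> and \<open>k + 1\<close> together sample the grid
      points \<open>k, ..., k + q + 1\<close>, hence windows of \<open>q + 1\<close> cells;
      \<open>k < n - q\<close> is precisely what keeps them inside \<open>{0..1}\<close>.\<close>
    proof (rule card_oscillation_windows_density_zero[OF g assms(5), where m = "q + 1" and C = "K / \<bar>c\<bar>"])
      fix n k v
      assume "k \<in> {k. k < n - q \<and> ?d n k * ?d n (k + 1) < 0}"
      then have kn: "k + (q + 1) \<le> n" and sign: "?d n k * ?d n (k + 1) < 0" by auto
      have n: "n > 0" using kn by simp
      have approx: "\<bar>real n ^ Suc m * ?d n j - v * c\<bar> \<le> K * real n * ?I n k (k + (q + 1)) v"
        if j: "j \<in> {k, k + 1}" for j
      proof -
        have "\<bar>real n ^ Suc m * ?d n j - v * c\<bar> \<le> K * real n * ?I n j (j + q) v"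
          using gen_increment_approx[of a m q F g n j v] a F g Fg n j kn p
          by (auto simp: c_def K_def F_def)
        also have "\<dots> \<le> K * real n * ?I n k (k + (q + 1)) v"
        proof (intro mult_left_mono integral_subset_le)
          have int: "(\<lambda>x. \<bar>g x - v\<bar>) integrable_on {real s / real n..real t / real n}" if "t \<le> n" for s t
          proof -
            have "(\<lambda>x. \<bar>g x - v\<bar>) absolutely_integrable_on {real s / real n..real t / real n}"
              by (intro set_integrable_abs set_integral_diff(1) absolutely_integrable_continuous_real
                  continuous_intros absolutely_integrable_on_subinterval[OF g grid_interval_subset_unit[OF n that]])
            then show ?thesis using set_lebesgue_integral_eq_integral(1) by blast
          qed
          show "(\<lambda>x. \<bar>g x - v\<bar>) integrable_on {real j / real n..real (j + q) / real n}"
            by (rule int) (use j kn in auto)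
          show "(\<lambda>x. \<bar>g x - v\<bar>) integrable_on {real k / real n..real (k + (q + 1)) / real n}"
            by (rule int) (rule kn)
          show "{real j / real n..real (j + q) / real n} \<subseteq> {real k / real n..real (k + (q + 1)) / real n}"
            using j by (auto simp: atLeastatMost_subset_iff divide_right_mono)
        qed (use K0 in auto)
        finally show ?thesis .
      qed
      \<comment> \<open>Scaling by the positive \<open>n ^ Suc m\<close> keeps the signs opposite,
        so one of the two scaled increments misses \<open>v * c\<close> by at least
        \<open>|v * c|\<close>.\<close>
      have "(real n ^ Suc m * ?d n k) * (real n ^ Suc m * ?d n (k + 1)) < 0"
        using sign n by (simp add: mult_less_0_iff zero_less_mult_iff)
      then have "\<bar>v * c\<bar> \<le> \<bar>real n ^ Suc m * ?d n k - v * c\<bar> \<or> \<bar>v * c\<bar> \<le> \<bar>real n ^ Suc m * ?d n (k + 1) - v * c\<bar>"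
        by (rule opposite_signs_imp_far)
      then have "\<bar>v\<bar> * \<bar>c\<bar> \<le> K * real n * ?I n k (k + (q + 1)) v"
        using approx[of k] approx[of "k + 1"] by (auto simp: abs_mult)
      then show "\<bar>v\<bar> \<le> K / \<bar>c\<bar> * real n * ?I n k (k + (q + 1)) v"
        using c0 by (simp add: pos_le_divide_eq)
    qed (use K0 in auto)
  qed
  then show ?thesis
    using binomial_filter_in_filters by (simp add: binomial_increment_ratio_def)
qed

end
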